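(* Consider the partially observed Gauss--Markov model described in the context and let $t\in\{1,\dots,T\}$. Assume that $h_{t:T\mid t}$ has the log-quadratic representation $$h_{t:T\mid t}(x)=c_{t:T\mid t}\exp\Big[-\tfrac12\big|\bar y_{t:T\mid t}-\bar C_{t:T\mid t}x\big|^2\Big]\qquad (x\in\mathbb{R}^n)$$ with $c_{t:T\mid t}>0$, $\bar y_{t:T\mid t}\in\mathbb{R}^{\bar m_{t:T\mid t}}$, $\bar C_{t:T\mid t}\in\mathbb{R}^{\bar m_{t:T\mid t}\times n}$ and $m\le\bar m_{t:T\mid t}\le n$. Define $$\begin{aligned} \hat R_{t:T\mid t-1}&=\mathrm{I}+\bar C_{t:T\mid t}Q_{t,t-1}\bar C_{t:T\mid t}^*,\\ \bar y_{t:T\mid t-1}&=\hat R_{t:T\mid t-1}^{-1/2}\big(\bar y_{t:T\mid t}-\bar C_{t:T\mid t}u_{t,t-1}\big),\\ \bar C_{t:T\mid t-1}&=\hat R_{t:T\mid t-1}^{-1/2}\bar C_{t:T\mid t}\Phi_{t,t-1},\\ \log c_{t:T\mid t-1}&=\log c_{t:T\mid t}-\tfrac12\log\det\hat R_{t:T\mid t-1},\\ \bar K^{t:T}_{t\mid t-1}&=Q_{t,t-1}\bar C_{t:T\mid t}^*\hat R_{t:T\mid t-1}^{-1},\\ \Phi^{t:T}_{t,t-1}&=\big(\mathrm{I}-\bar K^{t:T}_{t\mid t-1}\bar C_{t:T\mid t}\big)\Phi_{t,t-1},\\ u^{t:T}_{t,t-1}&=u_{t,t-1}+\bar K^{t:T}_{t\mid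 t-1}\big(\bar y_{t:T\mid t}-\bar C_{t:T\mid t}u_{t,t-1}\big),\\ Q^{t:T}_{t,t-1}&=Q_{t,t-1}-\bar K^{t:T}_{t\mid t-1}\hat R_{t:T\mid t-1}\big(\bar K^{t:T}_{t\mid t-1}\big)^*. \end{aligned}$$ Then, for all $x,z\in\mathbb{R}^n$, $$h_{t:T\mid t-1}(x)=c_{t:T\mid t-1}\exp\Big[-\tfrac12\big|\bar y_{t:T\mid t-1}-\bar C_{t:T\mid t-1}x\big|^2\Big],\qquad \pi^{t:T}_{t\mid t-1}(\cdot\mid z)=\mathcal{N}\big(\Phi^{t:T}_{t,t-1}z+u^{t:T}_{t,t-1},\,Q^{t:T}_{t,t-1}\big),$$ where $\bar y_{t:T\mid t-1}\in\mathbb{R}^{\bar m_{t:T\mid t-1}}$, $\bar C_{t:T\mid t-1}\in\mathbb{R}^{\bar m_{t:T\mid t-1}\times n}$ and $\hat R_{t:T\mid t-1}\in\mathbb{R}^{\bar m_{t:T\mid t-1}\times\bar m_{t:T\mid t-1}}$ with $\bar m_{t:T\mid t-1}=\bar m_{t:T\mid t}$.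
   Context: Model. Let $1\le m\le n$ and $T\ge 1$ be integers. The states $x_0,\dots,x_T$ take values in $\mathbb{R}^n$ and the measurements $y_1,\dots,y_T$ in $\mathbb{R}^m$, with $$x_0\sim\mathcal{N}(\mu_0,\Sigma_0),\qquad x_t\mid x_{t-1}\sim\pi_{t\mid t-1}(\cdot\mid x_{t-1})=\mathcal{N}(\Phi_{t,t-1}x_{t-1}+u_{t,t-1},\,Q_{t,t-1}),\qquad y_t\mid x_t\sim\mathcal{N}(C_tx_t,R_t),$$ for $t=1,\dots,T$, where $\Phi_{t,t-1}\in\mathbb{R}^{n\times n}$, $u_{t,t-1}\in\mathbb{R}^n$, $C_t\in\mathbb{R}^{m\times n}$, $\Sigma_0,Q_{t,t-1}\in\mathbb{R}^{n\times n}$ are symmetric positive semidefinite, and each $R_t\in\mathbb{R}^{m\times m}$ is symmetric positive definite. $\mathcal{N}(\mu,\Sigma)$ is the Gaussian distribution with mean $\mu$ and covariance $\Sigma$ (possibly degenerate). $\Phi_{t,t-1}$ and $Q_{t,t-1}$ need not be invertible. Likelihoods. The measurement sequence $y_1,\dots,y_T$ is fixed and omitted from the notation. $h_{t\mid t}(x)$ is the density of $\mathcal{N}(C_tx,R_t)$ evaluated at $y_t$. For $s\in\{t-1,t\}$, $h_{t:T\mid s}(x)$ is the conditional density of $y_{t:T}=(y_t,\dots,y_T)$ given $x_s=x$, evaluated at the fixed measurements; it is determined by $h_{T:T\mid T}=h_{T\mid T}$ and $$h_{t:T\mid t-1}(z)=\int h_{t:T\mid t}(x)\,\pi_{t\mid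 t-1}(\mathrm{d}x\mid z)\ \ (1\le t\le T),\qquad h_{t-1:T\mid t-1}(x)=h_{t-1\mid t-1}(x)\,h_{t:T\mid t-1}(x)\ \ (2\le t\le T).$$ Posterior transitions. $\pi^{t:T}_{t\mid t-1}(\cdot\mid z)$ is the conditional distribution of $x_t$ given $x_{t-1}=z$ and $y_{t:T}$, i.e. $$\pi^{t:T}_{t\mid t-1}(\mathrm{d}x\mid z)=\frac{h_{t:T\mid t}(x)\,\pi_{t\mid t-1}(\mathrm{d}x\mid z)}{h_{t:T\mid t-1}(z)}.$$ Matrix notation. $^*$ is the transpose, $|\cdot|$ the Euclidean norm. For a symmetric positive definite $R$, $R^{1/2}$ is its (lower triangular, positive diagonal) Cholesky factor, $R=R^{1/2}R^{*/2}$ with $R^{*/2}=(R^{1/2})^*$, and $R^{-1/2}=(R^{1/2})^{-1}$. *)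

theory Defs
  imports "HOL-Probability.Probability"
begin

definition pos_semidef :: "real ^ 'n ^ 'n \<Rightarrow> bool" where
  "pos_semidef S \<longleftrightarrow> transpose S = S \<and> (\<forall>v. 0 \<le> v \<bullet> (S *v v))"

definition pos_def :: "real ^ 'n ^ 'n \<Rightarrow> bool" where
  "pos_def S \<longleftrightarrow> transpose S = S \<and> (\<forall>v. v \<noteq> 0 \<longrightarrow> 0 < v \<bullet> (S *v v))"

text \<open>
  Triangularity refers to an order of the coordinates, hence the linearly ordered index type.
  A positive definite matrix has exactly one factor of this kind, so the choice is immaterial.
\<close>

definition is_cholesky_factor ::
    "real ^ ('k::{finite,linorder}) ^ ('k::{finite,linorder}) \<Rightarrow>
      real ^ ('k::{finite,linorder}) ^ ('k::{finite,linorder}) \<Rightarrow> bool" where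
  "is_cholesky_factor R L \<longleftrightarrow>
     (\<forall>i j. i < j \<longrightarrow> L $ i $ j = 0) \<and> (\<forall>i. 0 < L $ i $ i) \<and> L ** transpose L = R"

definition cholesky ::
    "real ^ ('k::{finite,linorder}) ^ ('k::{finite,linorder}) \<Rightarrow>
      real ^ ('k::{finite,linorder}) ^ ('k::{finite,linorder})" where
  "cholesky R = (SOME L. is_cholesky_factor R L)"

definition std_gaussian :: "(real ^ 'n) measure" where
  "std_gaussian = density lborel (\<lambda>v. ennreal (\<Prod>i\<in>UNIV. std_normal_density (v $ i)))"

text \<open>
  The possibly degenerate Gaussian distribution is the law of \<open>\<mu> + A Z\<close> with \<open>Z\<close> standard
  Gaussian and \<open>A A\<^sup>T = S\<close>; such an \<open>A\<close> exists for every positive semidefinite \<open>S\<close>, and the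
  law does not depend on which one is taken.  For other \<open>S\<close> the value is the null measure, so
  that no probability measure equals \<open>gaussian \<mu> S\<close> unless \<open>S\<close> is a covariance matrix.
\<close>

definition gaussian :: "real ^ 'n \<Rightarrow> real ^ 'n ^ 'n \<Rightarrow> (real ^ 'n) measure" where
  "gaussian \<mu> S =
     (if pos_semidef S
      then distr std_gaussian borel (\<lambda>v. \<mu> + (SOME A :: real ^ 'n ^ 'n. A ** transpose A = S) *v v)
      else null_measure borel)"

definition gaussian_density :: "real ^ 'm \<Rightarrow> real ^ 'm ^ 'm \<Rightarrow> real ^ 'm \<Rightarrow> real" where
  "gaussian_density \<mu> R y =
     exp (- ((y - \<mu>) \<bullet> (matrix_inv R *v (y - \<mu>))) / 2) / sqrt ((2 * pi) ^ CARD('m) * det R)"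

text \<open>
  The fields \<open>Phi\<close>, \<open>offset\<close>, \<open>Qcov\<close> at index \<open>t\<close> belong to the transition from time \<open>t - 1\<close> to
  time \<open>t\<close>; these and \<open>Cobs\<close>, \<open>Rcov\<close> are only meaningful for \<open>1 \<le> t \<le> horizon\<close>.
\<close>

record ('n::finite, 'm::finite) gauss_markov =
  horizon :: nat
  init_mean :: "real ^ 'n"
  init_cov :: "real ^ 'n ^ 'n"
  Phi :: "nat \<Rightarrow> real ^ 'n ^ 'n"
  offset :: "nat \<Rightarrow> real ^ 'n"
  Qcov :: "nat \<Rightarrow> real ^ 'n ^ 'n"
  Cobs :: "nat \<Rightarrow> real ^ 'n ^ 'm"
  Rcov :: "nat \<Rightarrow> real ^ 'm ^ 'm"

definition gauss_markov_model :: "('n::finite, 'm::finite) gauss_markov \<Rightarrow> bool" where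
  "gauss_markov_model G \<longleftrightarrow>
     CARD('m) \<le> CARD('n) \<and> 1 \<le> horizon G \<and> pos_semidef (init_cov G) \<and>
     (\<forall>t\<in>{1..horizon G}. pos_semidef (Qcov G t) \<and> pos_def (Rcov G t))"

definition transition ::
    "('n::finite, 'm::finite) gauss_markov \<Rightarrow> nat \<Rightarrow> real ^ 'n \<Rightarrow> (real ^ 'n) measure" where
  "transition G t z = gaussian (Phi G t *v z + offset G t) (Qcov G t)"

definition meas_lik ::
    "('n::finite, 'm::finite) gauss_markov \<Rightarrow> (nat \<Rightarrow> real ^ 'm) \<Rightarrow> nat \<Rightarrow> real ^ 'n \<Rightarrow> real" where
  "meas_lik G y t x = gaussian_density (Cobs G t *v x) (Rcov G t) (y t)"

text \<open>
  With \<open>T = horizon G\<close>, \<open>lik_filt G y t\<close> is \<open>h\<^bsub>t:T|t\<^esub>\<close> and \<open>lik_pred G y t\<close> is \<open>h\<^bsub>t:T|t-1\<^esub>\<close>, the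
  conditional density of the measurements \<open>y t, \<dots>, y T\<close> given the state at time \<open>t\<close> and
  \<open>t - 1\<close>, respectively.  The integral in the recursion is \<open>lik_pred G y (t + 1) x\<close>.
\<close>

function lik_filt ::
    "('n::finite, 'm::finite) gauss_markov \<Rightarrow> (nat \<Rightarrow> real ^ 'm) \<Rightarrow> nat \<Rightarrow> real ^ 'n \<Rightarrow> real" where
  "lik_filt G y t x =
     meas_lik G y t x *
     (if t < horizon G then (\<integral>x'. lik_filt G y (t + 1) x' \<partial>transition G (t + 1) x) else 1)"
  by auto
termination by (relation "Wellfounded.measure (\<lambda>(G, y, t, x). horizon G - t)") auto

declare lik_filt.simps [simp del]

definition lik_pred ::
    "('n::finite, 'm::finite) gauss_markov \<Rightarrow> (nat \<Rightarrow> real ^ 'm) \<Rightarrow> nat \<Rightarrow> real ^ 'n \<Rightarrow> real" where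
  "lik_pred G y t z = (\<integral>x. lik_filt G y t x \<partial>transition G t z)"

lemma lik_filt_horizon: "lik_filt G y (horizon G) x = meas_lik G y (horizon G) x"
  by (subst lik_filt.simps) simp

lemma lik_filt_step:
  assumes "2 \<le> t" "t \<le> horizon G"
  shows "lik_filt G y (t - 1) x = meas_lik G y (t - 1) x * lik_pred G y t x"
  using assms by (subst lik_filt.simps) (auto simp: lik_pred_def)

definition post_transition ::
    "('n::finite, 'm::finite) gauss_markov \<Rightarrow> (nat \<Rightarrow> real ^ 'm) \<Rightarrow> nat \<Rightarrow> real ^ 'n \<Rightarrow>
      (real ^ 'n) measure" where
  "post_transition G y t z =
     density (transition G t z) (\<lambda>x. ennreal (lik_filt G y t x / lik_pred G y t z))"

end

theory Submission
  imports Defs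
begin

text \<open>
  Write \<open>Q = A A\<^sup>T\<close> and \<open>x = m + A v\<close> with standard Gaussian \<open>v\<close>, put \<open>B = C A\<close> and let \<open>r\<close> be the
  residual of \<open>m\<close>.  Then \<open>S = I + B B\<^sup>T\<close> is \<open>Rhat\<close>, and completing the square shows that weighting the
  law of \<open>v\<close> with \<open>exp (- |r - B v|\<^sup>2 / 2)\<close> gives, up to the factor
  \<open>exp (- r \<bullet> S\<^sup>-\<^sup>1 r / 2) / sqrt (det S)\<close>, the law of \<open>B\<^sup>T S\<^sup>-\<^sup>1 r + D v\<close> with
  \<open>D D\<^sup>T = I - B\<^sup>T S\<^sup>-\<^sup>1 B\<close>.  Pushing this forward along \<open>m + A v\<close> yields the posterior transition,
  and its total mass is the predicted likelihood.  Degenerate \<open>Q\<close> needs no separate treatment,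
  because only the law of \<open>v\<close> has to have a density.
\<close>

subsection \<open>Lebesgue measure under linear maps\<close>

definition std_gaussian_density :: "real ^ 'n \<Rightarrow> real" where
  "std_gaussian_density v = (\<Prod>i\<in>UNIV. std_normal_density (v $ i))"

text \<open>The coordinates enter only through \<open>v \<bullet> v\<close>. Evenness, invariance
  under orthogonal maps and completing the square all rest on this.\<close>

lemma std_gaussian_density_eq:
  "std_gaussian_density (v :: real ^ 'n) = (1 / sqrt (2 * pi)) ^ CARD('n) * exp (- (v \<bullet> v) / 2)"
proof -
  have "std_gaussian_density v = (\<Prod>i\<in>UNIV. (1 / sqrt (2 * pi)) * exp (- (v $ i)\<^sup>2 / 2))"
    by (simp add: std_gaussian_density_def std_normal_density_def)
  also have "\<dots> = (1 / sqrt (2 * pi)) ^ CARD('n) * exp (\<Sum>i\<in>UNIV. - (v $ i)\<^sup>2 / 2)"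
    by (simp only: prod.distrib exp_sum finite_class.finite_UNIV prod_constant)
  also have "(\<Sum>i\<in>UNIV. - (v $ i)\<^sup>2 / 2) = - (v \<bullet> v) / 2"
    by (simp add: inner_vec_def power2_eq_square sum_negf flip: sum_divide_distrib)
  finally show ?thesis .
qed

lemma std_gaussian_density_minus: "std_gaussian_density (- v) = std_gaussian_density v"
  by (simp add: std_gaussian_density_eq)

lemma std_gaussian_density_measurable [measurable]: "std_gaussian_density \<in> borel_measurable borel"
  unfolding std_gaussian_density_eq [abs_def] by measurable

lemma Basis_vec_cart: "(Basis :: (real ^ 'n) set) = range (\<lambda>i. axis i 1)"
  by (auto simp: Basis_vec_def)

text \<open>The integrand is a product over coordinates, so the integral splits into one-dimensional
  normal integrals, each equal to 1.\<close>

lemma std_gaussian_density_normalized: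
  "(\<integral>\<^sup>+v. ennreal (std_gaussian_density (v :: real ^ 'n)) \<partial>lborel) = 1"
proof -
  \<comment> \<open>\<open>nn_integral_lborel_prod\<close> indexes coordinates by basis vectors, the
    density by \<open>'n\<close>; injectivity of \<open>axis\<close> translates between the
    two.\<close>
  have B: "(\<Prod>b\<in>Basis. g b) = (\<Prod>i\<in>UNIV. g (axis i (1::real)))"
    for g :: "real ^ 'n \<Rightarrow> ennreal"
  proof -
    have "inj (\<lambda>i :: 'n. axis i (1::real))"
      by (auto simp: inj_on_def axis_eq_axis)
    then show ?thesis
      by (simp only: Basis_vec_cart prod.reindex comp_def)
  qed
  have "(\<integral>\<^sup>+v. ennreal (std_gaussian_density (v :: real ^ 'n)) \<partial>lborel)
      = (\<integral>\<^sup>+v. (\<Prod>b\<in>Basis. ennreal (std_normal_density (v \<bullet> b))) \<partial>(lborel :: (real ^ 'n) measure))"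
    by (simp add: B std_gaussian_density_def prod_ennreal inner_axis)
  also have "\<dots> = (\<Prod>b\<in>(Basis :: (real ^ 'n) set). \<integral>\<^sup>+x. ennreal (std_normal_density x) \<partial>lborel)"
    by (rule nn_integral_lborel_prod) auto
  also have "(\<integral>\<^sup>+x. ennreal (std_normal_density x) \<partial>lborel) = 1"
    using prob_space.emeasure_space_1[OF prob_space_normal_density[of 1 0]]
    by (simp add: emeasure_density)
  finally show ?thesis by simp
qed

section \<open>Translations and invertible linear maps acting on Lebesgue measure\<close>

lemma nn_integral_lborel_translate:
  fixes f :: "'a::euclidean_space \<Rightarrow> ennreal"
  assumes [measurable]: "f \<in> borel_measurable borel"
  shows "(\<integral>\<^sup>+x. f (a + x) \<partial>lborel) = (\<integral>\<^sup>+x. f x \<partial>lborel)"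
  by (subst (2) lborel_distr_plus[of a, symmetric]) (simp add: nn_integral_distr)

lemma borel_measurable_matrix_vector_mult [measurable (raw)]:
  fixes A :: "real ^ 'n ^ 'm"
  assumes "f \<in> borel_measurable M"
  shows "(\<lambda>x. A *v f x) \<in> borel_measurable M"
  by (rule borel_measurable_continuous_on[OF _ assms])
     (intro continuous_intros)

text \<open>The factor \<open>k\<close> will turn out to be the absolute determinant of
  \<open>A\<close>, but is kept abstract until existence and uniqueness are known. Quantifying over
  integrands rather than sets makes the property compose by substitution.\<close>

definition rescales_lborel :: "real ^ 'n ^ 'n \<Rightarrow> real \<Rightarrow> bool" where
  "rescales_lborel A k \<longleftrightarrow> 0 < k \<and>
     (\<forall>f\<in>borel_measurable borel. ennreal k * (\<integral>\<^sup>+x. f (A *v x) \<partial>lborel) = (\<integral>\<^sup>+x. f x \<partial>lborel))"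

lemma rescales_lborel_mult:
  assumes "rescales_lborel A k" "rescales_lborel B l"
  shows "rescales_lborel (A ** B) (k * l)"
  unfolding rescales_lborel_def
proof (intro conjI ballI)
  fix f :: "real ^ 'a \<Rightarrow> ennreal" assume [measurable]: "f \<in> borel_measurable borel"
  have "ennreal (k * l) * (\<integral>\<^sup>+x. f ((A ** B) *v x) \<partial>lborel)
      = ennreal k * (ennreal l * (\<integral>\<^sup>+x. f (A *v (B *v x)) \<partial>lborel))"
    using assms by (simp add: rescales_lborel_def ennreal_mult matrix_vector_mul_assoc mult.assoc)
  also have "ennreal l * (\<integral>\<^sup>+x. f (A *v (B *v x)) \<partial>lborel) = (\<integral>\<^sup>+x. f (A *v x) \<partial>lborel)"
    using assms(2) unfolding rescales_lborel_def by (auto dest!: bspec[where x="\<lambda>x. f (A *v x)"])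
  also have "ennreal k * \<dots> = (\<integral>\<^sup>+x. f x \<partial>lborel)"
    using assms(1) by (simp add: rescales_lborel_def)
  finally show "ennreal (k * l) * (\<integral>\<^sup>+x. f ((A ** B) *v x) \<partial>lborel) = (\<integral>\<^sup>+x. f x \<partial>lborel)" .
qed (use assms in \<open>simp add: rescales_lborel_def\<close>)

text \<open>The Gaussian density serves as a test function: its integral is 1, so \<open>k\<close>
  times the pulled-back integral is 1. That integral is therefore neither zero nor infinite and
  determines \<open>k\<close>.\<close>

lemma rescales_lborel_unique:
  assumes "rescales_lborel (A :: real ^ 'n ^ 'n) k" "rescales_lborel A l"
  shows "k = l"
proof -
  let ?I = "\<integral>\<^sup>+x. ennreal (std_gaussian_density (A *v x)) \<partial>lborel"
  have k: "0 < k" "ennreal k * ?I = 1" and l: "0 < l" "ennreal l * ?I = 1"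
    using assms std_gaussian_density_normalized[where 'n='n]
    by (auto simp: rescales_lborel_def dest!: bspec[where x="\<lambda>x. ennreal (std_gaussian_density x)"])
  then have "?I \<noteq> \<infinity>" "?I \<noteq> 0"
    by (auto simp: ennreal_mult_top)
  then show ?thesis
    using k l by (metis ennreal_inj ennreal_mult_divide_eq ennreal_divide_self infinity_ennreal_def less_imp_le)
qed

lemma rescales_lborel_mat_1: "rescales_lborel (mat 1) 1"
  by (simp add: rescales_lborel_def)

text \<open>Uniqueness of Haar measure: average against the even density \<open>std_gaussian_density\<close>, use
  Tonelli and translate.\<close>

lemma rescales_lborel_exists:
  fixes A :: "real ^ 'n ^ 'n"
  assumes "invertible A"
  shows "\<exists>k. rescales_lborel A k"
proof -
  obtain B where AB: "A ** B = mat 1" and BA: "B ** A = mat 1"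
    using assms by (auto simp: invertible_def)
  have A_B: "A *v (B *v x) = x" and B_A: "B *v (A *v x) = x" for x
    by (simp_all add: matrix_vector_mul_assoc AB BA)
  let ?g = "\<lambda>x. ennreal (std_gaussian_density (x :: real ^ 'n))"
  \<comment> \<open>Once the integral of \<open>?g (A *v v)\<close> is known to be finite and
    nonzero, this identity makes the two functionals of \<open>f\<close> proportional.\<close>
  have *: "(\<integral>\<^sup>+x. f x \<partial>lborel) * (\<integral>\<^sup>+v. ?g (A *v v) \<partial>lborel) = (\<integral>\<^sup>+v. f (A *v v) \<partial>lborel)"
    if [measurable]: "f \<in> borel_measurable borel" for f
  proof -
    have "(\<integral>\<^sup>+x. f x \<partial>lborel) * (\<integral>\<^sup>+v. ?g (A *v v) \<partial>lborel)
        = (\<integral>\<^sup>+v. (\<integral>\<^sup>+x. f (A *v v + x) \<partial>lborel) * ?g (A *v v) \<partial>lborel)"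
      by (simp add: nn_integral_cmult nn_integral_lborel_translate)
    also have "\<dots> = (\<integral>\<^sup>+v. (\<integral>\<^sup>+x. f (A *v v + x) * ?g (A *v v) \<partial>lborel) \<partial>lborel)"
      by (simp add: nn_integral_multc)
    also have "\<dots> = (\<integral>\<^sup>+x. (\<integral>\<^sup>+v. f (A *v v + x) * ?g (A *v v) \<partial>lborel) \<partial>lborel)"
      by (rule lborel_pair.Fubini') measurable
    \<comment> \<open>Shifting \<open>v\<close> by \<open>- (B *v x)\<close> moves \<open>x\<close>
      out of \<open>f\<close> and into \<open>?g\<close>, so that after the next exchange only
      \<open>?g\<close> is integrated over \<open>x\<close>.\<close>
    also have "\<dots> = (\<integral>\<^sup>+x. (\<integral>\<^sup>+v. f (A *v v) * ?g (A *v v - x) \<partial>lborel) \<partial>lborel)"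
    proof (rule nn_integral_cong)
      fix x :: "real ^ 'n"
      show "(\<integral>\<^sup>+v. f (A *v v + x) * ?g (A *v v) \<partial>lborel)
          = (\<integral>\<^sup>+v. f (A *v v) * ?g (A *v v - x) \<partial>lborel)"
        by (subst nn_integral_lborel_translate[of "\<lambda>v. f (A *v v + x) * ?g (A *v v)" "- (B *v x)", symmetric])
           (auto simp: matrix_vector_right_distrib matrix_vector_mult_diff_distrib A_B)
    qed
    also have "\<dots> = (\<integral>\<^sup>+v. (\<integral>\<^sup>+x. f (A *v v) * ?g (A *v v - x) \<partial>lborel) \<partial>lborel)"
      by (rule lborel_pair.Fubini') measurable
    also have "\<dots> = (\<integral>\<^sup>+v. f (A *v v) * (\<integral>\<^sup>+x. ?g (- (A *v v) + x) \<partial>lborel) \<partial>lborel)"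
    proof (rule nn_integral_cong)
      fix v :: "real ^ 'n"
      have "?g (A *v v - x) = ?g (- (A *v v) + x)" for x
        using std_gaussian_density_minus[of "A *v v - x"] by simp
      then show "(\<integral>\<^sup>+x. f (A *v v) * ?g (A *v v - x) \<partial>lborel)
          = f (A *v v) * (\<integral>\<^sup>+x. ?g (- (A *v v) + x) \<partial>lborel)"
        by (simp add: nn_integral_cmult)
    qed
    also have "\<dots> = (\<integral>\<^sup>+v. f (A *v v) \<partial>lborel)"
      by (subst nn_integral_lborel_translate[of ?g]) (simp_all add: std_gaussian_density_normalized)
    finally show ?thesis .
  qed
  let ?I = "\<integral>\<^sup>+v. ?g (A *v v) \<partial>lborel" and ?J = "\<integral>\<^sup>+v. ?g (B *v v) \<partial>lborel"
  \<comment> \<open>Taking \<open>f\<close> to be \<open>?g\<close> composed with \<open>B\<close>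
    shows that \<open>?J\<close> is the reciprocal of \<open>?I\<close>, which makes
    \<open>?J\<close> the required factor.\<close>
  have JI: "?J * ?I = 1"
    using *[of "\<lambda>x. ?g (B *v x)"] by (simp add: B_A std_gaussian_density_normalized)
  then have "?J \<noteq> 0" "?J \<noteq> \<infinity>"
    using *[of "\<lambda>x. ?g (B *v x)"] 
    by (auto simp: ennreal_top_mult split: if_splits)
  then obtain k where k: "0 < k" "?J = ennreal k"
    by (cases ?J) (auto simp: less_le)
  have "rescales_lborel A k"
    unfolding rescales_lborel_def
  proof (intro conjI ballI)
    fix f :: "real ^ 'n \<Rightarrow> ennreal" assume f: "f \<in> borel_measurable borel"
    have "ennreal k * (\<integral>\<^sup>+v. f (A *v v) \<partial>lborel) = ?J * ((\<integral>\<^sup>+x. f x \<partial>lborel) * ?I)"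
      by (simp only: k *[OF f])
    also have "\<dots> = (?J * ?I) * (\<integral>\<^sup>+x. f x \<partial>lborel)"
      by (simp only: ac_simps)
    finally show "ennreal k * (\<integral>\<^sup>+v. f (A *v v) \<partial>lborel) = (\<integral>\<^sup>+x. f x \<partial>lborel)"
      by (simp add: JI)
  qed fact
  then show ?thesis ..
qed

text \<open>Factors multiply under composition, so the factor squares to 1 and, being positive,
  equals 1. The determinant also squares to 1. Transpositions and shears are reduced to this
  case.\<close>

lemma rescales_lborel_involution:
  assumes "A ** A = mat 1"
  shows "rescales_lborel A \<bar>det A\<bar>"
proof -
  obtain k where k: "rescales_lborel A k"
    using rescales_lborel_exists assms by (auto simp: invertible_def)
  have "k * k = 1"
    using rescales_lborel_unique[OF rescales_lborel_mult[OF k k]] rescales_lborel_mat_1 assms by simp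
  moreover have "0 < k"
    using k by (simp add: rescales_lborel_def)
  ultimately have "k = 1"
    by (metis abs_of_pos real_sqrt_abs2 real_sqrt_one)
  moreover have "det A * det A = 1"
    using assms by (metis det_I det_mul)
  then have "\<bar>det A\<bar> = 1"
    by (metis real_sqrt_abs2 real_sqrt_one)
  ultimately show ?thesis
    using k by simp
qed

lemma rescales_lborel_diagonal:
  fixes A :: "real ^ 'n ^ 'n"
  assumes diag: "\<And>i j. i \<noteq> j \<Longrightarrow> A $ i $ j = 0" and "det A \<noteq> 0"
  shows "rescales_lborel A \<bar>det A\<bar>"
  unfolding rescales_lborel_def
proof (intro conjI ballI)
  fix f :: "real ^ 'n \<Rightarrow> ennreal" assume [measurable]: "f \<in> borel_measurable borel"
  \<comment> \<open>On \<open>axis i 1\<close> this is the diagonal entry \<open>A $ i $ i\<close>;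
    \<open>lborel_affine_euclidean\<close> expects scalings indexed by basis vectors.\<close>
  let ?c = "\<lambda>b. (A *v b) \<bullet> b"
  have det: "det A = (\<Prod>i\<in>UNIV. A $ i $ i)"
    by (rule det_diagonal) (use diag in auto)
  have c: "(A *v axis i 1) $ i = A $ i $ i" for i
    by (simp add: matrix_vector_mult_basis column_def)
  have inj: "inj (\<lambda>i :: 'n. axis i (1::real))"
    by (auto simp: inj_on_def axis_eq_axis)
  have nz: "?c b \<noteq> 0" if "b \<in> Basis" for b
    using that \<open>det A \<noteq> 0\<close> by (auto simp: Basis_vec_cart det c inner_axis)
  have prod: "(\<Prod>b\<in>Basis. \<bar>?c b\<bar>) = \<bar>det A\<bar>"
    by (simp add: Basis_vec_cart prod.reindex[OF inj] det abs_prod c inner_axis)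
  have A: "0 + (\<Sum>j\<in>Basis. (?c j * (x \<bullet> j)) *\<^sub>R j) = A *v x" for x
  proof -
    have "(\<Sum>j\<in>Basis. (?c j * (x \<bullet> j)) *\<^sub>R j) = (\<Sum>i\<in>UNIV. (A $ i $ i * x $ i) *\<^sub>R axis i 1)"
      by (simp add: Basis_vec_cart sum.reindex[OF inj] c inner_axis)
    also have "\<dots> = A *v x"
    proof -
      have "(\<Sum>j\<in>UNIV. A $ i $ j * x $ j) = A $ i $ i * x $ i" for i
        by (subst sum.remove[of _ i]) (auto simp: diag intro!: sum.neutral)
      then show ?thesis
        by (simp add: vec_eq_iff matrix_vector_mult_def axis_def if_distrib cong: if_cong)
    qed
    finally show ?thesis by simp
  qed
  show "ennreal \<bar>det A\<bar> * (\<integral>\<^sup>+x. f (A *v x) \<partial>lborel) = (\<integral>\<^sup>+x. f x \<partial>lborel)"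
    by (subst (2) lborel_affine_euclidean[where c="?c" and t=0])
       (use nz in \<open>simp_all only: A prod\<close>, simp_all add: nn_integral_density nn_integral_distr nn_integral_cmult)
qed (use assms in simp)

text \<open>Induction over products of elementary matrices: both the factor and the absolute
  determinant are multiplicative, and a zero row is excluded by the nonzero determinant.\<close>

lemma rescales_lborel_det:
  fixes A :: "real ^ 'n ^ 'n"
  assumes "det A \<noteq> 0"
  shows "rescales_lborel A \<bar>det A\<bar>"
proof -
  have "det A \<noteq> 0 \<longrightarrow> rescales_lborel A \<bar>det A\<bar>"
  proof (induction rule: induct_matrix_elementary_alt)
    case (1 A B)
    then show ?case
      using rescales_lborel_mult[of A _ B] by (auto simp: det_mul abs_mult)
  next
    case (2 A i)
    then show ?case
      by (simp add: det_zero_row)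
  next
    case (3 A)
    then show ?case
      by (simp add: rescales_lborel_diagonal)
  next
    case (4 m n)
    have "(\<Sum>k\<in>UNIV. (if i = Transposition.transpose m n k then 1 else 0) *
        (if k = Transposition.transpose m n j then 1 else 0 :: real)) = (if i = j then 1 else 0)" for i j
      by (subst sum.remove[of _ "Transposition.transpose m n j"]) (auto intro!: sum.neutral)
    then show ?case
      by (intro impI rescales_lborel_involution)
         (simp add: vec_eq_iff matrix_matrix_mult_def mat_def)
  next
    case (5 m n)
    text \<open>A shear is a product of two reflections.\<close>
    let ?T = "\<chi> i j. of_bool (i = m \<and> j = n \<or> i = j) :: real ^ 'n ^ 'n"
    let ?D = "\<chi> i j. if i = j then (if i = m then - 1 else 1) else 0 :: real ^ 'n ^ 'n"
    have D: "?D ** ?D = mat 1"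
    proof -
      have "(\<Sum>k\<in>UNIV. ?D $ i $ k * ?D $ k $ j) = (if i = j then 1 else 0)" for i j
        by (subst sum.remove[of _ i]) (auto intro!: sum.neutral)
      then show ?thesis
        by (simp add: vec_eq_iff mat_def matrix_matrix_mult_def)
    qed
    \<comment> \<open>Entries of \<open>?T ** ?D\<close>, which is \<open>?T\<close> with column
      \<open>m\<close> negated. It differs from the identity only in row \<open>m\<close>.\<close>
    define w :: "'n \<Rightarrow> 'n \<Rightarrow> real" where
      "w i j = (if i = j then (if i = m then - 1 else 1) else if i = m \<and> j = n then 1 else 0)" for i j
    have TD_eq: "?T ** ?D = (\<chi> i j. w i j)"
      unfolding w_def using 5 by (auto simp: vec_eq_iff matrix_matrix_mult_def if_distrib cong: if_cong)
    have "(\<Sum>k\<in>UNIV. w i k * w k j) = (if i = j then 1 else 0)" for i j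
    proof -
      have "(\<Sum>k\<in>UNIV. w i k * w k j) = (\<Sum>k\<in>insert i (if i = m then {n} else {}). w i k * w k j)"
        by (rule sum.mono_neutral_right) (auto simp: w_def)
      also have "\<dots> = (if i = m then w m m * w m j + w m n * w n j else w i i * w i j)"
        using 5 by (simp only: split: if_split) simp
      also have "\<dots> = (if i = j then 1 else 0)"
        using 5 by (cases "i = m"; cases "j = m"; cases "j = n"; cases "i = j") (simp_all add: w_def)
      finally show ?thesis .
    qed
    then have TD: "(?T ** ?D) ** (?T ** ?D) = mat 1"
      unfolding TD_eq by (simp add: vec_eq_iff matrix_matrix_mult_def mat_def)
    have "rescales_lborel ((?T ** ?D) ** ?D) \<bar>det ((?T ** ?D) ** ?D)\<bar>"
      using rescales_lborel_mult[OF rescales_lborel_involution[OF TD] rescales_lborel_involution[OF D]]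
      by (simp only: det_mul abs_mult)
    then show ?case
      by (simp only: D matrix_mul_rid matrix_mul_assoc[symmetric] simp_thms)
  qed
  with assms show ?thesis by simp
qed

subsection \<open>Matrix factorizations\<close>

lemma inner_matrix_vector: "(A *v x) \<bullet> y = x \<bullet> (transpose A *v (y :: real ^ 'm))"
  by (metis dot_lmul_matrix transpose_transpose transpose_matrix_vector)

lemma matrix_diff_ldistrib: "A ** (B - C) = A ** B - A ** (C :: real ^ 'n ^ 'm)"
  by (vector matrix_matrix_mult_def sum_subtractf right_diff_distrib)

lemma matrix_diff_rdistrib: "(A - B) ** C = A ** C - B ** (C :: real ^ 'n ^ 'm)"
  by (vector matrix_matrix_mult_def sum_subtractf left_diff_distrib)

lemma transpose_add: "transpose (A + B) = transpose A + transpose B"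
  by (vector transpose_def)

lemma transpose_diff: "transpose (A - B) = transpose A - transpose B"
  by (vector transpose_def)

lemma transpose_matrix_mult_self: "transpose (A ** transpose A) = A ** transpose (A :: real ^ 'n ^ 'm)"
  by (simp add: matrix_transpose_mul)

lemma inner_matrix_mult_self: "v \<bullet> ((A ** transpose A) *v v) = (transpose A *v v) \<bullet> (transpose A *v v)"
  for A :: "real ^ 'n ^ 'm"
  by (metis inner_matrix_vector matrix_vector_mul_assoc transpose_transpose)

lemma pos_semidef_matrix_mult_self: "pos_semidef (A ** transpose A)"
  by (simp only: pos_semidef_def inner_matrix_mult_self transpose_matrix_mult_self inner_ge_zero simp_thms)

lemma matrix_inv_right: "invertible A \<Longrightarrow> A ** matrix_inv A = mat 1"
  and matrix_inv_left: "invertible A \<Longrightarrow> matrix_inv A ** A = mat 1"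
  unfolding invertible_def matrix_inv_def by (metis (mono_tags, lifting) someI_ex)+

lemma pos_def_invertible:
  assumes "pos_def S" shows "invertible S"
proof -
  have "inj ((*v) S)"
    unfolding linear_injective_0[OF matrix_vector_mul_linear]
    using assms by (metis inner_zero_right less_irrefl pos_def_def)
  then show ?thesis
    by (metis invertible_left_inverse matrix_left_invertible_injective)
qed

lemma pos_def_imp_pos_semidef: "pos_def S \<Longrightarrow> pos_semidef S"
  unfolding pos_def_def pos_semidef_def by (metis inner_zero_left less_imp_le order_refl)

text \<open>Induction on the number of coordinates not yet eliminated: subtracting the rank-one matrix of
  the normalised column \<open>p\<close> leaves the Schur complement.\<close>

lemma triangular_factor_off:
  fixes S :: "real ^ 'n ^ 'n" and rank :: "'n \<Rightarrow> nat"
  assumes "pos_semidef S" and "\<And>i j. i \<in> J \<or> j \<in> J \<Longrightarrow> S $ i $ j = 0"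
  shows "\<exists>L. L ** transpose L = S \<and> (\<forall>i j. rank i < rank j \<longrightarrow> L $ i $ j = 0) \<and>
    (\<forall>i j. i \<in> J \<or> j \<in> J \<longrightarrow> L $ i $ j = 0) \<and>
    ((\<forall>v. v \<noteq> 0 \<longrightarrow> (\<forall>i\<in>J. v $ i = 0) \<longrightarrow> 0 < v \<bullet> (S *v v)) \<longrightarrow> (\<forall>i. i \<notin> J \<longrightarrow> 0 < L $ i $ i))"
  using assms
proof (induction "card (- J)" arbitrary: S J)
  case 0
  then have "J = UNIV" by auto
  then show ?case
    using 0 by (intro exI[of _ 0]) (auto simp: vec_eq_iff)
next
  case (Suc k)
  from Suc.hyps(2) have "- J \<noteq> {}" by auto
  \<comment> \<open>Minimal rank among the remaining coordinates ensures that every index of smaller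
    rank is already eliminated, so column \<open>p\<close> vanishes there. This gives
    triangularity.\<close>
  then obtain p where p: "p \<notin> J" and least: "\<And>i. rank i < rank p \<Longrightarrow> i \<in> J"
    using ex_has_least_nat[of "\<lambda>i. i \<notin> J" _ rank] by (metis ComplD ex_in_conv linorder_not_le)
  let ?e = "axis p 1 :: real ^ 'n"
  define d where "d = S $ p $ p"
  \<comment> \<open>A vanishing pivot forces the whole column to vanish, as \<open>zero\<close>
    shows, so the zero vector is the right choice in that case.\<close>
  define l where "l = (\<chi> i. if d = 0 then 0 else S $ i $ p / sqrt d)"
  define S' where "S' = S - (\<chi> i j. l $ i * l $ j)"
  have sym: "S $ i $ j = S $ j $ i" for i j
  proof -
    have "transpose S $ j $ i = S $ j $ i"
      using Suc.prems(1) by (simp only: pos_semidef_def)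
    then show ?thesis by (simp add: transpose_def)
  qed
  have Se: "S *v ?e = (\<chi> i. S $ i $ p)"
    by (simp add: matrix_vector_mult_basis column_def)
  have vSe: "v \<bullet> (S *v ?e) = ?e \<bullet> (S *v v)" for v
    using Suc.prems(1) by (metis inner_commute inner_matrix_vector pos_semidef_def)
  have eSe: "?e \<bullet> (S *v ?e) = d"
    by (simp add: Se inner_axis' d_def)
  have "0 \<le> d"
    using Suc.prems(1) eSe by (metis pos_semidef_def)
  have quad: "(v + s *\<^sub>R ?e) \<bullet> (S *v (v + s *\<^sub>R ?e)) = v \<bullet> (S *v v) + 2 * s * (v \<bullet> (S *v ?e)) + s\<^sup>2 * d" for v s
    by (simp add: matrix_vector_right_distrib matrix_vector_mult_scaleR inner_add_left inner_add_right
        eSe vSe[of v] power2_eq_square algebra_simps)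
  \<comment> \<open>With a zero pivot \<open>quad\<close> is affine in \<open>s\<close>. A nonzero
    entry would allow a choice of \<open>s\<close> giving the value -1, against
    semidefiniteness.\<close>
  have zero: "S $ i $ p = 0" if "d = 0" for i
  proof (rule ccontr)
    let ?a = "S $ i $ p" and ?b = "axis i 1 \<bullet> (S *v axis i (1::real))"
    assume "?a \<noteq> 0"
    have "axis i 1 \<bullet> (S *v ?e) = ?a"
      by (simp add: Se inner_axis')
    then have "0 \<le> ?b + 2 * (- (?b + 1) / (2 * ?a)) * ?a"
      using quad[of "axis i 1" "- (?b + 1) / (2 * ?a)"] Suc.prems(1) that
      by (metis add.right_neutral mult_zero_right pos_semidef_def)
    then show False
      using \<open>?a \<noteq> 0\<close> by (simp add: field_simps)
  qed
  have ll: "l $ i * l $ j = S $ i $ p * S $ j $ p / d" for i j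
    using \<open>0 \<le> d\<close> by (auto simp: l_def)
  have lv: "l \<bullet> v = (if d = 0 then 0 else v \<bullet> (S *v ?e) / sqrt d)" for v
    by (simp add: l_def Se inner_vec_def sum_divide_distrib mult.commute)
  have vS'v: "v \<bullet> (S' *v v) = v \<bullet> (S *v v) - (l \<bullet> v)\<^sup>2" for v
  proof -
    have "(\<chi> i j. l $ i * l $ j) *v v = (l \<bullet> v) *\<^sub>R l"
      by (simp add: vec_eq_iff matrix_vector_mult_def inner_vec_def sum_distrib_left sum_distrib_right ac_simps)
    then show ?thesis
      by (simp add: S'_def matrix_vector_mult_diff_rdistrib inner_diff_right inner_commute power2_eq_square)
  qed
  \<comment> \<open>For \<open>d > 0\<close> this \<open>s\<close> minimises the quadratic, so the
    Schur complement inherits semidefiniteness. For \<open>d = 0\<close> division by zero gives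
    \<open>s = 0\<close>, and the identity persists because \<open>l\<close> is zero.\<close>
  have S'_quad: "v \<bullet> (S' *v v) = (v + s *\<^sub>R ?e) \<bullet> (S *v (v + s *\<^sub>R ?e))"
    if "s = - (v \<bullet> (S *v ?e)) / d" for v s
    using \<open>0 \<le> d\<close> unfolding quad vS'v lv that
    by (cases "d = 0") (auto simp: power_divide power2_eq_square field_simps)
  have S'_psd: "pos_semidef S'"
    using Suc.prems(1) unfolding pos_semidef_def S'_quad[OF refl]
    by (auto simp: S'_def transpose_def vec_eq_iff mult.commute)
  have S'_0: "S' $ i $ j = 0" if "i \<in> insert p J \<or> j \<in> insert p J" for i j
    using that Suc.prems(2)[of i p] Suc.prems(2)[of j p] Suc.prems(2)[of i j] zero sym[of p j] 
    by (cases "d = 0") (auto simp: S'_def ll, auto simp: d_def)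
  have card: "k = card (- insert p J)"
    using Suc.hyps(2) p by (simp add: Compl_insert card_Diff_singleton)
  have "\<exists>L. L ** transpose L = S' \<and> (\<forall>i j. rank i < rank j \<longrightarrow> L $ i $ j = 0) \<and>
      (\<forall>i j. i \<in> insert p J \<or> j \<in> insert p J \<longrightarrow> L $ i $ j = 0) \<and>
      ((\<forall>v. v \<noteq> 0 \<longrightarrow> (\<forall>i\<in>insert p J. v $ i = 0) \<longrightarrow> 0 < v \<bullet> (S' *v v)) \<longrightarrow>
        (\<forall>i. i \<notin> insert p J \<longrightarrow> 0 < L $ i $ i))"
    by (rule Suc.hyps(1)[OF card S'_psd S'_0])
  then obtain L where L: "L ** transpose L = S'" "\<forall>i j. rank i < rank j \<longrightarrow> L $ i $ j = 0"
      "\<forall>i j. i \<in> insert p J \<or> j \<in> insert p J \<longrightarrow> L $ i $ j = 0"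
    and L_pos: "(\<forall>v. v \<noteq> 0 \<longrightarrow> (\<forall>i\<in>insert p J. v $ i = 0) \<longrightarrow> 0 < v \<bullet> (S' *v v)) \<longrightarrow>
      (\<forall>i. i \<notin> insert p J \<longrightarrow> 0 < L $ i $ i)"
    by (elim exE conjE)
  \<comment> \<open>Column \<open>p\<close> of \<open>L\<close> is zero, since \<open>p\<close>
    counts as eliminated there. Putting \<open>l\<close> in its place adds back exactly the rank-one
    part removed in \<open>S'\<close>.\<close>
  define M where "M = (\<chi> i j. if j = p then l $ i else L $ i $ j)"
  have l0: "l $ i = 0" if "i \<in> J" for i
    using that Suc.prems(2) by (simp add: l_def)
  have "M ** transpose M = S"
  proof -
    have "(M ** transpose M) $ i $ j = S $ i $ j" for i j
    proof -
      have "(M ** transpose M) $ i $ j = l $ i * l $ j + (\<Sum>k\<in>UNIV - {p}. L $ i $ k * L $ j $ k)"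
        by (simp add: matrix_matrix_mult_def transpose_def sum.remove[of _ p] M_def)
      also have "(\<Sum>k\<in>UNIV - {p}. L $ i $ k * L $ j $ k) = (L ** transpose L) $ i $ j"
        by (simp add: matrix_matrix_mult_def transpose_def sum.remove[of _ p] L(3))
      finally show ?thesis
        by (simp add: L(1) S'_def)
    qed
    then show ?thesis
      by (simp add: vec_eq_iff)
  qed
  moreover have "M $ i $ j = 0" if "rank i < rank j" for i j
    using that least l0 L(2) by (auto simp: M_def)
  moreover have "M $ i $ j = 0" if "i \<in> J \<or> j \<in> J" for i j
    using that p l0 L(3) by (auto simp: M_def)
  moreover have "0 < M $ i $ i"
    if pos: "\<forall>v. v \<noteq> 0 \<longrightarrow> (\<forall>i\<in>J. v $ i = 0) \<longrightarrow> 0 < v \<bullet> (S *v v)" and "i \<notin> J" for i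
  proof (cases "i = p")
    case True
    have "0 < d"
    proof -
      have "?e \<noteq> 0" "\<forall>i\<in>J. ?e $ i = 0"
        using p by (simp add: axis_eq_0_iff) (use p in \<open>auto simp: axis_def\<close>)
      then show ?thesis
        using pos unfolding eSe[symmetric] by blast
    qed
    then show ?thesis
      using True by (simp add: M_def l_def flip: d_def)
  next
    case False
    have "0 < v \<bullet> (S' *v v)" if "v \<noteq> 0" "\<forall>i\<in>insert p J. v $ i = 0" for v
    proof -
      \<comment> \<open>\<open>?w\<close> differs from \<open>v\<close> only in coordinate
        \<open>p\<close>, where \<open>v\<close> vanishes, so it is nonzero and definiteness of
        \<open>S\<close> applies to it.\<close>
      let ?w = "v + (- (v \<bullet> (S *v ?e)) / d) *\<^sub>R ?e"
      obtain q where "v $ q \<noteq> 0"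
        using \<open>v \<noteq> 0\<close> by (auto simp: vec_eq_iff)
      then have "?w $ q \<noteq> 0"
        using that by (auto simp: axis_def)
      then have "?w \<noteq> 0"
        by (metis zero_index)
      moreover have "\<forall>i\<in>J. ?w $ i = 0"
        using that p by (auto simp: axis_def)
      ultimately show ?thesis
        using pos unfolding S'_quad[OF refl] by blast
    qed
    then show ?thesis
      using L_pos False \<open>i \<notin> J\<close> by (simp add: M_def)
  qed
  ultimately show ?case
    by blast
qed

text \<open>A constant \<open>rank\<close> makes the triangularity clause vacuous, leaving a plain
  factorization over an arbitrary finite index type.\<close>

lemma pos_semidef_factor:
  assumes "pos_semidef (S :: real ^ 'n ^ 'n)"
  shows "\<exists>A :: real ^ 'n ^ 'n. A ** transpose A = S"
  using triangular_factor_off[of S "{}" "\<lambda>_. 0"] assms by auto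

lemma is_cholesky_factor_cholesky:
  assumes "pos_def R"
  shows "is_cholesky_factor R (cholesky R)"
proof -
  have "pos_semidef R"
    using assms by (rule pos_def_imp_pos_semidef)
  \<comment> \<open>Counting predecessors turns the order of the index type into a rank in the
    natural numbers.\<close>
  moreover have "card {..<i} < card {..<j}" if "i < j" for i j :: 'a
    using that by (intro psubset_card_mono) auto
  ultimately have "\<exists>L. is_cholesky_factor R L"
    using triangular_factor_off[of R "{}" "\<lambda>i. card {..<i}"] assms
    unfolding is_cholesky_factor_def pos_def_def by (simp only: empty_iff) blast
  then show ?thesis
    unfolding cholesky_def by (rule someI_ex)
qed

text \<open>The isometry \<open>transpose A *v x \<mapsto> transpose B *v x\<close> between the row spaces extends to an
  orthogonal map, since the orthogonal complements of the row spaces have equal dimension.\<close>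

lemma orthogonal_matrix_between_factors:
  fixes A B :: "real ^ 'n ^ 'n"
  assumes eq: "A ** transpose A = B ** transpose B"
  obtains U where "orthogonal_matrix U" "A = B ** U"
proof -
  let ?A = "(*v) (transpose A)" and ?B = "(*v) (transpose B)"
  have norm_eq: "norm (?A x) = norm (?B x)" for x
    by (metis eq inner_matrix_mult_self norm_eq_sqrt_inner)
  \<comment> \<open>\<open>g\<close> chooses preimages linearly. By \<open>norm_eq\<close> the two
    maps have the same kernel, so following \<open>g\<close> by \<open>?B\<close> does not depend on
    that choice and is isometric on \<open>?P\<close>.\<close>
  obtain g where g: "linear g" "\<And>x. ?A (g (?A x)) = ?A x"
    using linear_exists_right_inverse_on[OF matrix_vector_mul_linear[of "transpose A"] subspace_UNIV] by auto
  have h: "?B (g (?A x)) = ?B x" for x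
  proof -
    have "norm (?B (g (?A x) - x)) = 0"
      by (simp only: norm_eq[symmetric]) (simp only: matrix_vector_mult_diff_distrib g, simp)
    then show ?thesis
      by (simp only: matrix_vector_mult_diff_distrib norm_eq_zero right_minus_eq)
  qed
  have lin_h: "linear (\<lambda>x. ?B (g x))"
    using linear_compose[OF g(1) matrix_vector_mul_linear] by (simp only: o_def)
  let ?P = "range ?A" and ?P' = "range ?B"
  let ?N = "{y \<in> UNIV. \<forall>x\<in>?P. orthogonal x y}" and ?N' = "{y \<in> UNIV. \<forall>x\<in>?P'. orthogonal x y}"
  have sub: "subspace ?P" "subspace ?P'"
    by (simp_all only: linear_subspace_image[OF matrix_vector_mul_linear] subspace_UNIV)
  have "(\<lambda>x. ?B (g x)) ` ?P = ?P'"
    by (simp only: image_image h)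
  moreover have "inj_on (\<lambda>x. ?B (g x)) (span ?P)"
    unfolding span_eq_iff[THEN iffD2, OF sub(1)] linear_inj_on_iff_eq_0[OF lin_h sub(1)]
  proof (intro ballI impI)
    fix v assume "v \<in> ?P" "?B (g v) = 0"
    then obtain x where "v = ?A x" "?B x = 0"
      using h by auto
    then show "v = 0"
      using norm_eq[of x] by simp
  qed
  ultimately have "dim ?P = dim ?P'"
    using dim_image_eq[OF lin_h] by metis
  then have "dim ?N = dim ?N'"
    using dim_subspace_orthogonal_to_vectors[OF sub(1) subspace_UNIV subset_UNIV]
      dim_subspace_orthogonal_to_vectors[OF sub(2) subspace_UNIV subset_UNIV] by linarith
  moreover have "subspace ?N" "subspace ?N'"
    by (auto simp: subspace_def orthogonal_clauses)
  ultimately obtain k k' where k: "linear k" "linear k'" "k ` ?N = ?N'" "k' ` ?N' = ?N"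
      "\<And>x. x \<in> ?N \<Longrightarrow> norm (k x) = norm x" "\<And>x. x \<in> ?N' \<Longrightarrow> norm (k' x) = norm x"
      "\<And>x. x \<in> ?N \<Longrightarrow> k' (k x) = x" "\<And>x. x \<in> ?N' \<Longrightarrow> k (k' x) = x"
    using isometries_subspaces[of ?N ?N' thesis] by blast
  obtain C where C: "C \<subseteq> ?P" "pairwise orthogonal C" "span C = ?P"
    using orthogonal_basis_subspace[OF sub(1)] by metis
  \<comment> \<open>Orthogonal projection onto \<open>?P\<close>, written in the orthogonal spanning
    set \<open>C\<close>.\<close>
  define \<pi> where "\<pi> x = (\<Sum>b\<in>C. (b \<bullet> x / (b \<bullet> b)) *\<^sub>R b)" for x
  have lin_\<pi>: "linear \<pi>"
    unfolding \<pi>_def by (auto intro!: linearI simp: inner_add_right add_divide_distrib scaleR_add_left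
        sum.distrib scaleR_sum_right)
  have \<pi>_in: "\<pi> x \<in> ?P" for x
    unfolding \<pi>_def C(3)[symmetric] by (intro span_sum span_mul span_base)
  have \<pi>_orth: "orthogonal w (x - \<pi> x)" if "w \<in> ?P" for w x
    unfolding \<pi>_def using Gram_Schmidt_step[OF C(2)] that C(3) by blast
  \<comment> \<open>The isometry on the component in \<open>?P\<close>, and \<open>k\<close> on the
    orthogonal component. The two images are orthogonal, so Pythagoras shows that norms are
    preserved.\<close>
  define V where "V x = ?B (g (\<pi> x)) + k (x - \<pi> x)" for x
  have lin_V: "linear V"
    unfolding V_def using linear_compose_add[OF linear_compose[OF lin_\<pi> lin_h]
        linear_compose[OF linear_compose_sub[OF linear_id lin_\<pi>] k(1)]] by (simp only: o_def id_def)
  have "norm (V x) = norm x" for x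
  proof -
    have N: "x - \<pi> x \<in> ?N"
      using \<pi>_orth by blast
    then have "k (x - \<pi> x) \<in> ?N'"
      using k(3) N by blast
    then have "orthogonal (?B (g (\<pi> x))) (k (x - \<pi> x))"
      by blast
    then have "(norm (V x))\<^sup>2 = (norm (?B (g (\<pi> x))))\<^sup>2 + (norm (k (x - \<pi> x)))\<^sup>2"
      unfolding V_def by (rule norm_add_Pythagorean)
    also have "norm (?B (g (\<pi> x))) = norm (\<pi> x)"
      using \<pi>_in[of x] by (auto simp only: h norm_eq)
    also have "norm (k (x - \<pi> x)) = norm (x - \<pi> x)"
      using k(5) N by blast
    also have "(norm (\<pi> x))\<^sup>2 + (norm (x - \<pi> x))\<^sup>2 = (norm (\<pi> x + (x - \<pi> x)))\<^sup>2"
      using norm_add_Pythagorean[OF \<pi>_orth[OF \<pi>_in[of x], of x]] by simp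
    finally show ?thesis by simp
  qed
  then have V: "orthogonal_transformation V"
    using lin_V by (simp add: orthogonal_transformation)
  have "V (?A x) = ?B x" for x
  proof -
    have "?A x - \<pi> (?A x) \<in> ?P"
      using \<pi>_in sub(1) by (metis rangeI subspace_diff)
    then have "?A x - \<pi> (?A x) = 0"
      using \<pi>_orth orthogonal_self by blast
    then show ?thesis
      using linear_0[OF k(1)] by (simp only: V_def h right_minus_eq) (metis add.right_neutral diff_self h)
  qed
  then have "(matrix V ** transpose A) *v x = transpose B *v x" for x
    by (metis matrix_vector_mul(2) lin_V matrix_vector_mul_assoc)
  then have "matrix V ** transpose A = transpose B"
    unfolding matrix_eq by blast
  then have "A ** transpose (matrix V) = B"
    by (metis matrix_transpose_mul transpose_transpose)
  moreover have orth: "orthogonal_matrix (matrix V)"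
    using V by (simp add: orthogonal_transformation_matrix)
  ultimately have "A = B ** matrix V"
    by (metis matrix_mul_assoc matrix_mul_rid orthogonal_matrix_def)
  with orth that show ?thesis by blast
qed

subsection \<open>Gaussian measures\<close>

lemma nn_integral_lborel_affine:
  fixes D :: "real ^ 'n ^ 'n"
  assumes "det D \<noteq> 0" and [measurable]: "f \<in> borel_measurable borel"
  shows "(\<integral>\<^sup>+x. f x \<partial>lborel) = ennreal \<bar>det D\<bar> * (\<integral>\<^sup>+x. f (w + D *v x) \<partial>lborel)"
proof -
  have "ennreal \<bar>det D\<bar> * (\<integral>\<^sup>+x. f (w + D *v x) \<partial>lborel) = (\<integral>\<^sup>+x. f (w + x) \<partial>lborel)"
    using rescales_lborel_det[OF assms(1)] unfolding rescales_lborel_def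
    by (auto dest!: bspec[where x="\<lambda>x. f (w + x)"])
  then show ?thesis
    by (simp add: nn_integral_lborel_translate)
qed

section \<open>The standard Gaussian law and its affine images\<close>

lemma std_gaussian_eq: "std_gaussian = density lborel (\<lambda>v. ennreal (std_gaussian_density v))"
  by (simp add: std_gaussian_def std_gaussian_density_def)

lemma sets_std_gaussian [simp, measurable_cong]: "sets std_gaussian = sets borel"
  and space_std_gaussian [simp]: "space std_gaussian = UNIV"
  by (simp_all add: std_gaussian_def)

lemma nn_integral_std_gaussian:
  assumes [measurable]: "f \<in> borel_measurable borel"
  shows "(\<integral>\<^sup>+v. f v \<partial>std_gaussian) = (\<integral>\<^sup>+v. ennreal (std_gaussian_density v) * f v \<partial>lborel)"
  unfolding std_gaussian_eq by (rule nn_integral_density) measurable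

lemma nn_integral_std_gaussian_const: "(\<integral>\<^sup>+v. k \<partial>(std_gaussian :: (real ^ 'n) measure)) = k"
  by (subst nn_integral_std_gaussian) (simp_all add: nn_integral_multc std_gaussian_density_normalized)

text \<open>The density depends only on \<open>v \<bullet> v\<close> and the substitution has
  absolute determinant 1.\<close>

lemma std_gaussian_orthogonal_invariant:
  fixes U :: "real ^ 'n ^ 'n"
  assumes "orthogonal_matrix U"
  shows "distr std_gaussian borel ((*v) U) = std_gaussian"
proof (rule measure_eqI)
  fix E assume "E \<in> sets (distr std_gaussian borel ((*v) U))"
  then have [measurable]: "E \<in> sets borel" by simp
  have "\<bar>det U\<bar> = 1"
    using det_orthogonal_matrix[OF assms] by auto
  then have "det U \<noteq> 0" by auto
  have dens: "std_gaussian_density (U *v v) = std_gaussian_density v" for v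
    using assms by (simp only: std_gaussian_density_eq inner_matrix_vector matrix_vector_mul_assoc
        orthogonal_matrix_def matrix_vector_mul_lid)
  have "emeasure (distr std_gaussian borel ((*v) U)) E = (\<integral>\<^sup>+v. indicator E (U *v v) \<partial>std_gaussian)"
    by (simp add: nn_integral_distr flip: nn_integral_indicator)
  also have "\<dots> = (\<integral>\<^sup>+v. ennreal (std_gaussian_density (U *v v)) * indicator E (U *v v) \<partial>lborel)"
    by (simp add: nn_integral_std_gaussian dens)
  also have "\<dots> = (\<integral>\<^sup>+v. ennreal (std_gaussian_density v) * indicator E v \<partial>lborel)"
    by (subst nn_integral_lborel_affine[OF \<open>det U \<noteq> 0\<close>, where w=0])
       (simp_all add: \<open>\<bar>det U\<bar> = 1\<close>)
  also have "\<dots> = emeasure std_gaussian E"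
    by (simp add: nn_integral_std_gaussian flip: nn_integral_indicator)
  finally show "emeasure (distr std_gaussian borel ((*v) U)) E = emeasure std_gaussian E" .
qed simp

text \<open>Frees the law from the factor picked by \<open>SOME\<close>: two square factors of
  \<open>S\<close> differ by an orthogonal matrix, which the standard Gaussian absorbs.\<close>

lemma gaussian_eq_distr:
  fixes A S :: "real ^ 'n ^ 'n"
  assumes A: "A ** transpose A = S"
  shows "gaussian \<mu> S = distr std_gaussian borel (\<lambda>v. \<mu> + A *v v)"
proof -
  let ?A = "SOME A :: real ^ 'n ^ 'n. A ** transpose A = S"
  have "?A ** transpose ?A = S"
    using A by (rule someI)
  then have "?A ** transpose ?A = A ** transpose A"
    by (simp only: A)
  then obtain U where U: "orthogonal_matrix U" "?A = A ** U"
    by (rule orthogonal_matrix_between_factors)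
  have "gaussian \<mu> S = distr std_gaussian borel (\<lambda>v. \<mu> + A *v (U *v v))"
    using pos_semidef_matrix_mult_self[of A] A U(2)
    by (simp add: gaussian_def matrix_vector_mul_assoc)
  also have "\<dots> = distr (distr std_gaussian borel ((*v) U)) borel (\<lambda>v. \<mu> + A *v v)"
    by (subst distr_distr) (simp_all add: comp_def)
  also have "\<dots> = distr std_gaussian borel (\<lambda>v. \<mu> + A *v v)"
    by (simp add: std_gaussian_orthogonal_invariant[OF U(1)])
  finally show ?thesis .
qed

section \<open>Weighting the standard Gaussian with a quadratic likelihood\<close>

lemma pos_def_mat_1_plus: "pos_def (mat 1 + B ** transpose (B :: real ^ 'n ^ 'k))"
  unfolding pos_def_def
proof (intro conjI allI impI)
  show "transpose (mat 1 + B ** transpose B) = mat 1 + B ** transpose B"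
    by (simp add: transpose_add transpose_matrix_mult_self)
  fix v :: "real ^ 'k" assume "v \<noteq> 0"
  then have "0 < v \<bullet> v" by simp
  then show "0 < v \<bullet> ((mat 1 + B ** transpose B) *v v)"
    unfolding matrix_vector_mult_add_rdistrib inner_add_right inner_matrix_mult_self matrix_vector_mul_lid
    using inner_ge_zero[of "transpose B *v v"] by linarith
qed

lemma matrix_inv_symmetric:
  assumes "invertible (S :: real ^ 'n ^ 'n)" "transpose S = S"
  shows "transpose (matrix_inv S) = matrix_inv S"
proof -
  have "transpose (matrix_inv S) = transpose (matrix_inv S) ** (S ** matrix_inv S)"
    using assms by (simp add: matrix_inv_right)
  also have "\<dots> = transpose (S ** matrix_inv S) ** matrix_inv S"
    by (simp only: matrix_mul_assoc matrix_transpose_mul assms(2))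
  also have "\<dots> = matrix_inv S"
    using assms by (simp add: matrix_inv_right)
  finally show ?thesis .
qed

text \<open>\<open>transpose L ** matrix_inv S\<close> is a right inverse of the square matrix
  \<open>L\<close>, hence also a left inverse. Used to whiten residuals with a factor of
  \<open>S\<close>.\<close>

lemma inner_matrix_inv_factor:
  fixes L S :: "real ^ 'k ^ 'k"
  assumes L: "L ** transpose L = S" and S: "invertible S"
  shows "(L *v x) \<bullet> (matrix_inv S *v (L *v x)) = x \<bullet> x"
proof -
  have "L ** (transpose L ** matrix_inv S) = mat 1"
    using matrix_inv_right[OF S] L by (simp only: matrix_mul_assoc)
  then have "(transpose L ** matrix_inv S) ** L = mat 1"
    by (simp only: matrix_left_right_inverse)
  then show ?thesis
    by (simp only: inner_matrix_vector matrix_vector_mul_assoc matrix_mul_assoc matrix_vector_mul_lid)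
qed

text \<open>By the Woodbury identity, \<open>N\<close> is the inverse of \<open>mat 1 + transpose B ** B\<close>.\<close>

lemma inverse_factor_woodbury:
  fixes B :: "real ^ 'n ^ 'k"
  defines "S \<equiv> mat 1 + B ** transpose B"
  defines "N \<equiv> mat 1 - transpose B ** matrix_inv S ** B"
  obtains D :: "real ^ 'n ^ 'n" where "D ** transpose D = N" "det D \<noteq> 0"
    "transpose D ** (mat 1 + transpose B ** B) ** D = mat 1"
proof -
  let ?M = "mat 1 + transpose B ** B"
  have inv: "invertible S"
    unfolding S_def by (intro pos_def_invertible pos_def_mat_1_plus)
  have "transpose S = S"
    unfolding S_def by (simp add: transpose_add transpose_matrix_mult_self)
  then have symI: "transpose (matrix_inv S) = matrix_inv S"
    by (rule matrix_inv_symmetric[OF inv])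
  have BBt: "B ** transpose B = S - mat 1"
    by (simp add: S_def)
  have "N ** ?M = mat 1 + transpose B ** B - transpose B ** matrix_inv S ** B
      - transpose B ** matrix_inv S ** (B ** transpose B) ** B"
    by (simp add: N_def matrix_add_ldistrib matrix_diff_rdistrib matrix_mul_assoc)
  also have "transpose B ** matrix_inv S ** (B ** transpose B) ** B
      = transpose B ** (matrix_inv S ** S) ** B - transpose B ** matrix_inv S ** B"
    by (simp add: BBt matrix_diff_ldistrib matrix_diff_rdistrib matrix_mul_assoc)
  finally have NM: "N ** ?M = mat 1"
    by (simp add: matrix_inv_left[OF inv])
  then have MN: "?M ** N = mat 1"
    by (simp only: matrix_left_right_inverse)
  have symN: "transpose N = N"
    by (simp add: N_def transpose_diff matrix_transpose_mul symI matrix_mul_assoc)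
  \<comment> \<open>Writing \<open>v\<close> as \<open>?M *v (N *v v)\<close> turns the form into a
    sum of two squares.\<close>
  have "0 \<le> v \<bullet> (N *v v)" for v
  proof -
    have "?M *v (N *v v) = v"
      by (simp only: matrix_vector_mul_assoc MN matrix_vector_mul_lid)
    then have "v \<bullet> (N *v v) = (N *v v) \<bullet> (?M *v (N *v v))"
      by (simp only: inner_commute)
    also have "\<dots> = (N *v v) \<bullet> (N *v v) + (B *v (N *v v)) \<bullet> (B *v (N *v v))"
      using inner_matrix_mult_self[of "N *v v" "transpose B"]
      by (simp only: matrix_vector_mult_add_rdistrib inner_add_right matrix_vector_mul_lid transpose_transpose)
    finally show ?thesis by simp
  qed
  then have "pos_semidef N"
    by (simp only: pos_semidef_def symN simp_thms)
  then obtain D :: "real ^ 'n ^ 'n" where D: "D ** transpose D = N"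
    using pos_semidef_factor[of N] by blast
  then have DM: "D ** (transpose D ** ?M) = mat 1"
    using NM by (simp only: matrix_mul_assoc)
  then have "(transpose D ** ?M) ** D = mat 1"
    by (simp only: matrix_left_right_inverse)
  moreover have "det D \<noteq> 0"
  proof
    assume "det D = 0"
    then show False
      using arg_cong[OF DM, of det] by (simp add: det_mul)
  qed
  ultimately show ?thesis
    using that D by blast
qed

text \<open>\<open>w r\<close> minimises the sum of the squared norms of \<open>v\<close> and
  \<open>r - B *v v\<close>, with minimum \<open>r \<bullet> (matrix_inv S *v r)\<close>. The
  remaining form \<open>mat 1 + transpose B ** B\<close> is reduced to the identity by
  \<open>D\<close>.\<close>

lemma gaussian_complete_square:
  fixes B :: "real ^ 'n ^ 'k" and D :: "real ^ 'n ^ 'n"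
  defines "S \<equiv> mat 1 + B ** transpose B"
  assumes D: "transpose D ** (mat 1 + transpose B ** B) ** D = mat 1"
  defines "w r \<equiv> transpose B *v (matrix_inv S *v r)"
  shows "std_gaussian_density (w r + D *v v) * exp (- (norm (r - B *v (w r + D *v v)))\<^sup>2 / 2)
    = exp (- (r \<bullet> (matrix_inv S *v r)) / 2) * std_gaussian_density v"
proof -
  have inv: "invertible S"
    unfolding S_def by (intro pos_def_invertible pos_def_mat_1_plus)
  let ?s = "matrix_inv S *v r" and ?d = "D *v v"
  have Ss: "S *v ?s = r"
    by (simp only: matrix_vector_mul_assoc matrix_inv_right[OF inv] matrix_vector_mul_lid)
  moreover have "S *v ?s = ?s + B *v w r"
    unfolding w_def
    by (simp only: S_def matrix_vector_mult_add_rdistrib matrix_vector_mul_lid matrix_vector_mul_assoc[symmetric])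
  ultimately have rs: "r = ?s + B *v w r"
    by simp
  then have res: "r - B *v (w r + ?d) = ?s - B *v ?d"
    by (simp add: matrix_vector_right_distrib algebra_simps)
  have ww: "w r \<bullet> w r = ?s \<bullet> (B *v w r)"
    unfolding w_def by (simp only: inner_matrix_vector transpose_transpose)
  \<comment> \<open>This makes the cross terms of the two squares cancel.\<close>
  have wd: "w r \<bullet> ?d = ?s \<bullet> (B *v ?d)"
    unfolding w_def by (simp only: inner_matrix_vector transpose_transpose)
  have "v \<bullet> v = ?d \<bullet> ((mat 1 + transpose B ** B) *v ?d)"
    using D by (simp only: inner_matrix_vector matrix_vector_mul_assoc matrix_mul_assoc matrix_vector_mul_lid)
  then have dd: "?d \<bullet> ?d + (B *v ?d) \<bullet> (B *v ?d) = v \<bullet> v"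
    using inner_matrix_mult_self[of ?d "transpose B"]
    by (simp only: matrix_vector_mult_add_rdistrib inner_add_right matrix_vector_mul_lid transpose_transpose)
  have "?s \<bullet> r = ?s \<bullet> ?s + ?s \<bullet> (B *v w r)"
    by (subst (2) rs) (simp only: inner_add_right)
  then have "(w r + ?d) \<bullet> (w r + ?d) + (norm (r - B *v (w r + ?d)))\<^sup>2 = r \<bullet> ?s + v \<bullet> v"
    unfolding res power2_norm_eq_inner dd[symmetric] using ww wd
    by (simp add: inner_add_left inner_add_right inner_diff_left inner_diff_right inner_commute)
  then have "exp (- ((w r + ?d) \<bullet> (w r + ?d)) / 2) * exp (- (norm (r - B *v (w r + ?d)))\<^sup>2 / 2)
      = exp (- (r \<bullet> ?s) / 2) * exp (- (v \<bullet> v) / 2)"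
    unfolding mult_exp_exp by (simp add: field_simps)
  then show ?thesis
    by (simp add: std_gaussian_density_eq)
qed

text \<open>The determinant of \<open>D\<close> is read off from the total mass of the joint density of \<open>v\<close> and
  \<open>B *v v + e\<close> with independent standard Gaussian \<open>v\<close> and \<open>e\<close>; this replaces Sylvester's determinant
  identity.\<close>

lemma nn_integral_std_gaussian_tilt:
  fixes B :: "real ^ 'n ^ 'k"
  defines "S \<equiv> mat 1 + B ** transpose B"
  obtains D :: "real ^ 'n ^ 'n" where "D ** transpose D = mat 1 - transpose B ** matrix_inv S ** B"
    "\<And>g r. g \<in> borel_measurable borel \<Longrightarrow>
      (\<integral>\<^sup>+v. ennreal (exp (- (norm (r - B *v v))\<^sup>2 / 2)) * g v \<partial>std_gaussian)
      = ennreal (exp (- (r \<bullet> (matrix_inv S *v r)) / 2) / sqrt (det S)) *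
        (\<integral>\<^sup>+v. g (transpose B *v (matrix_inv S *v r) + D *v v) \<partial>std_gaussian)"
proof -
  have inv: "invertible S"
    unfolding S_def by (intro pos_def_invertible pos_def_mat_1_plus)
  obtain D where D: "D ** transpose D = mat 1 - transpose B ** matrix_inv S ** B" "det D \<noteq> 0"
      "transpose D ** (mat 1 + transpose B ** B) ** D = mat 1"
    using inverse_factor_woodbury[of B] unfolding S_def by metis
  \<comment> \<open>The claim with its constant still expressed through \<open>det D\<close>:
    substitute \<open>?w + D *v v\<close> and complete the square.\<close>
  have tilt: "(\<integral>\<^sup>+v. ennreal (exp (- (norm (r - B *v v))\<^sup>2 / 2)) * g v \<partial>std_gaussian)
      = ennreal (\<bar>det D\<bar> * exp (- (r \<bullet> (matrix_inv S *v r)) / 2)) *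
        (\<integral>\<^sup>+v. g (transpose B *v (matrix_inv S *v r) + D *v v) \<partial>std_gaussian)"
    if [measurable]: "g \<in> borel_measurable borel" for g r
  proof -
    let ?w = "transpose B *v (matrix_inv S *v r)"
    let ?c = "exp (- (r \<bullet> (matrix_inv S *v r)) / 2)"
    have "(\<integral>\<^sup>+v. ennreal (exp (- (norm (r - B *v v))\<^sup>2 / 2)) * g v \<partial>std_gaussian)
        = (\<integral>\<^sup>+v. ennreal (std_gaussian_density v * exp (- (norm (r - B *v v))\<^sup>2 / 2)) * g v \<partial>lborel)"
      by (simp add: nn_integral_std_gaussian ennreal_mult'' mult.assoc)
    also have "\<dots> = ennreal \<bar>det D\<bar> *
        (\<integral>\<^sup>+v. ennreal (?c * std_gaussian_density v) * g (?w + D *v v) \<partial>lborel)"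
      by (subst nn_integral_lborel_affine[OF D(2), where w="?w"])
         (simp_all only: gaussian_complete_square[OF D(3), folded S_def], measurable)
    also have "\<dots> = ennreal (\<bar>det D\<bar> * ?c) * (\<integral>\<^sup>+v. g (?w + D *v v) \<partial>std_gaussian)"
      by (simp add: nn_integral_std_gaussian ennreal_mult' mult.assoc nn_integral_cmult)
    finally show ?thesis .
  qed
  obtain L :: "real ^ 'k ^ 'k" where L: "L ** transpose L = S"
    using pos_semidef_factor[OF pos_def_imp_pos_semidef[OF pos_def_mat_1_plus[of B]]] unfolding S_def by blast
  have "det S = det L * det L"
    by (simp add: det_mul flip: L)
  then have sqrt_det: "sqrt (det S) = \<bar>det L\<bar>"
    by simp
  have "det S \<noteq> 0"
    using inv by (simp add: invertible_det_nz)
  then have "det L \<noteq> 0"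
    using \<open>det S = det L * det L\<close> by auto
  let ?k = "(1 / sqrt (2 * pi)) ^ CARD('k)"
  have dens: "ennreal (std_gaussian_density (- (B *v v) + r)) = ennreal ?k * ennreal (exp (- (norm (r - B *v v))\<^sup>2 / 2))" for v and r :: "real ^ 'k"
    by (simp add: std_gaussian_density_eq power2_norm_eq_inner flip: ennreal_mult')
  \<comment> \<open>Integrating over \<open>r\<close> first gives mass 1. The exchanged order, with
    \<open>tilt\<close> for a constant \<open>g\<close>, gives the determinant of \<open>D\<close>
    times a Gaussian integral in \<open>r\<close>.\<close>
  have "1 = (\<integral>\<^sup>+v. (\<integral>\<^sup>+r. ennreal (std_gaussian_density (- (B *v v) + r)) \<partial>lborel) \<partial>std_gaussian)"
    by (subst nn_integral_lborel_translate[of "\<lambda>r. ennreal (std_gaussian_density r)"])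
       (simp_all only: std_gaussian_density_normalized nn_integral_std_gaussian_const, measurable)
  also have "\<dots> = (\<integral>\<^sup>+v. (\<integral>\<^sup>+r. ennreal (std_gaussian_density v) * ennreal (std_gaussian_density (- (B *v v) + r)) \<partial>lborel) \<partial>lborel)"
    by (subst nn_integral_std_gaussian) (simp_all add: nn_integral_cmult)
  also have "\<dots> = (\<integral>\<^sup>+r. (\<integral>\<^sup>+v. ennreal (std_gaussian_density v) * ennreal (std_gaussian_density (- (B *v v) + r)) \<partial>lborel) \<partial>lborel)"
    by (rule lborel_pair.Fubini') measurable
  also have "\<dots> = (\<integral>\<^sup>+r. (\<integral>\<^sup>+v. ennreal (exp (- (norm (r - B *v v))\<^sup>2 / 2)) * ennreal ?k \<partial>std_gaussian) \<partial>lborel)"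
    by (simp only: dens) (simp add: nn_integral_std_gaussian ac_simps)
  also have "\<dots> = (\<integral>\<^sup>+r. ennreal \<bar>det D\<bar> * ennreal (?k * exp (- (r \<bullet> (matrix_inv S *v r)) / 2)) \<partial>lborel)"
    by (simp only: tilt[OF borel_measurable_const] nn_integral_std_gaussian_const)
       (simp add: ennreal_mult' ac_simps)
  also have "\<dots> = ennreal \<bar>det D\<bar> * (\<integral>\<^sup>+r. ennreal (?k * exp (- (r \<bullet> (matrix_inv S *v r)) / 2)) \<partial>lborel)"
    by (rule nn_integral_cmult) measurable
  \<comment> \<open>Substituting \<open>L *v x\<close> for \<open>r\<close> makes the form standard
    and contributes \<open>\<bar>det L\<bar>\<close>, which is \<open>sqrt (det S)\<close>.\<close>
  also have "(\<integral>\<^sup>+r. ennreal (?k * exp (- (r \<bullet> (matrix_inv S *v r)) / 2)) \<partial>lborel)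
      = ennreal \<bar>det L\<bar> * (\<integral>\<^sup>+x. ennreal (std_gaussian_density x) \<partial>(lborel :: (real ^ 'k) measure))"
    by (subst nn_integral_lborel_affine[OF \<open>det L \<noteq> 0\<close>, where w=0])
       (simp_all add: inner_matrix_inv_factor[OF L inv] std_gaussian_density_eq)
  finally have "ennreal (\<bar>det D\<bar> * \<bar>det L\<bar>) = 1"
    by (simp add: std_gaussian_density_normalized ennreal_mult')
  then have "\<bar>det D\<bar> * \<bar>det L\<bar> = 1"
    by (simp add: ennreal_eq_1)
  then have "\<bar>det D\<bar> = 1 / sqrt (det S)"
    using \<open>det L \<noteq> 0\<close> by (simp add: sqrt_det field_simps)
  then show ?thesis
    using that[OF D(1)] tilt by simp
qed

subsection \<open>The backward filter step\<close>

theorem proposition1: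
  fixes G :: "('n::finite, 'm::finite) gauss_markov"
    and y :: "nat \<Rightarrow> real ^ 'm"
    and t :: nat
    and c c' :: real
    and ybar ybar' :: "real ^ ('k::{finite,linorder})"
    and Cbar Cbar' :: "real ^ 'n ^ ('k::{finite,linorder})"
    and Rhat :: "real ^ ('k::{finite,linorder}) ^ ('k::{finite,linorder})"
    and Kbar :: "real ^ ('k::{finite,linorder}) ^ 'n"
    and Phi' Q' :: "real ^ 'n ^ 'n"
    and u' :: "real ^ 'n"
  assumes "gauss_markov_model G"
    and "t \<in> {1..horizon G}"
    and "CARD('m) \<le> CARD('k)" and "CARD('k) \<le> CARD('n)"
    and "0 < c"
    and "\<And>x. lik_filt G y t x = c * exp (- (1 / 2) * (norm (ybar - Cbar *v x))\<^sup>2)"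
    and "Rhat = mat 1 + Cbar ** Qcov G t ** transpose Cbar"
    and "ybar' = matrix_inv (cholesky Rhat) *v (ybar - Cbar *v offset G t)"
    and "Cbar' = matrix_inv (cholesky Rhat) ** Cbar ** Phi G t"
    and "c' = exp (ln c - 1 / 2 * ln (det Rhat))"
    and "Kbar = Qcov G t ** transpose Cbar ** matrix_inv Rhat"
    and "Phi' = (mat 1 - Kbar ** Cbar) ** Phi G t"
    and "u' = offset G t + Kbar *v (ybar - Cbar *v offset G t)"
    and "Q' = Qcov G t - Kbar ** Rhat ** transpose Kbar"
  shows "\<forall>x z. lik_pred G y t x = c' * exp (- (1 / 2) * (norm (ybar' - Cbar' *v x))\<^sup>2) \<and>
           post_transition G y t z = gaussian (Phi' *v z + u') Q'"
proof (intro allI conjI)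
  fix x z :: "real ^ 'n"
  let ?Q = "Qcov G t" and ?C = "Cbar" and ?Si = "matrix_inv Rhat"
  have "pos_semidef ?Q"
    using assms(1,2) by (simp add: gauss_markov_model_def)
  then obtain A :: "real ^ 'n ^ 'n" where A: "A ** transpose A = ?Q"
    using pos_semidef_factor[of ?Q] by blast
  let ?B = "Cbar ** A"
  have R: "Rhat = mat 1 + ?B ** transpose ?B"
    by (simp only: assms(7) matrix_transpose_mul matrix_mul_assoc A[symmetric])
  have pd: "pos_def Rhat"
    unfolding R by (rule pos_def_mat_1_plus)
  then have inv: "invertible Rhat"
    by (rule pos_def_invertible)
  obtain D :: "real ^ 'n ^ 'n" where D: "D ** transpose D = mat 1 - transpose ?B ** ?Si ** ?B"
    and tilt: "\<And>g r. g \<in> borel_measurable borel \<Longrightarrow>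
      (\<integral>\<^sup>+v. ennreal (exp (- (norm (r - ?B *v v))\<^sup>2 / 2)) * g v \<partial>std_gaussian)
      = ennreal (exp (- (r \<bullet> (?Si *v r)) / 2) / sqrt (det Rhat)) *
        (\<integral>\<^sup>+v. g (transpose ?B *v (?Si *v r) + D *v v) \<partial>std_gaussian)"
    using nn_integral_std_gaussian_tilt[of ?B] unfolding R by blast
  have L: "cholesky Rhat ** transpose (cholesky Rhat) = Rhat"
    using is_cholesky_factor_cholesky[OF pd] by (simp add: is_cholesky_factor_def)
  have det_L: "det Rhat = det (cholesky Rhat) * det (cholesky Rhat)"
    using arg_cong[OF L, of det] by (simp add: det_mul)
  have "det Rhat \<noteq> 0"
    using inv by (simp add: invertible_det_nz)
  then have "0 < det Rhat"
    unfolding det_L by (simp add: less_le)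
  have L_inv: "invertible (cholesky Rhat)"
    using \<open>det Rhat \<noteq> 0\<close> det_L by (simp add: invertible_det_nz)
  have "1 / 2 * ln (det Rhat) = ln (sqrt (det Rhat))"
    using \<open>0 < det Rhat\<close> by (simp add: ln_sqrt)
  then have c': "c' = c / sqrt (det Rhat)"
    using \<open>0 < c\<close> \<open>0 < det Rhat\<close> by (simp only: assms(10) exp_diff exp_ln real_sqrt_gt_zero)
  define m where "m z = Phi G t *v z + offset G t" for z
  define r where "r z = ybar - Cbar *v m z" for z
  have r': "ybar' - Cbar' *v z = matrix_inv (cholesky Rhat) *v r z" for z
    by (simp add: assms(8,9) r_def m_def matrix_vector_mult_diff_distrib matrix_vector_right_distrib
        matrix_vector_mul_assoc matrix_mul_assoc)
  \<comment> \<open>Multiplying by the inverse Cholesky factor whitens the residual, so its squared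
    norm is the quadratic form that \<open>tilt\<close> produces.\<close>
  have norm_r: "(norm (ybar' - Cbar' *v z))\<^sup>2 = r z \<bullet> (?Si *v r z)" for z
  proof -
    have "cholesky Rhat *v (ybar' - Cbar' *v z) = r z"
      by (simp only: r' matrix_vector_mul_assoc matrix_inv_right[OF L_inv] matrix_vector_mul_lid)
    then show ?thesis
      using inner_matrix_inv_factor[OF L inv, of "ybar' - Cbar' *v z"] by (simp add: power2_norm_eq_inner)
  qed
  have transition: "transition G t z = distr std_gaussian borel (\<lambda>v. m z + A *v v)" for z
    by (simp add: transition_def gaussian_eq_distr[OF A] m_def)
  have lik: "lik_filt G y t = (\<lambda>x. c * exp (- (norm (ybar - Cbar *v x))\<^sup>2 / 2))"
    using assms(6) by (intro ext) simp
  have lik_measurable [measurable]: "lik_filt G y t \<in> borel_measurable borel"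
    unfolding lik by measurable
  have lik_transition: "lik_filt G y t (m z + A *v v) = c * exp (- (norm (r z - ?B *v v))\<^sup>2 / 2)" for z v
    by (simp add: lik r_def matrix_vector_right_distrib matrix_vector_mul_assoc diff_diff_add)
  \<comment> \<open>Predicted likelihood up to the factor \<open>c\<close>; its reciprocal
    normalises the weighted law.\<close>
  define e where "e z = exp (- (r z \<bullet> (?Si *v r z)) / 2) / sqrt (det Rhat)" for z
  have e_pos: "0 < e z" for z
    using \<open>0 < det Rhat\<close> by (simp add: e_def)
  have pred: "lik_pred G y t z = c * e z" for z
  proof -
    \<comment> \<open>\<open>tilt\<close> concerns nonnegative integrals; the value passes to the
      Bochner integral in \<open>lik_pred\<close> because the integrand is nonnegative and
      measurable.\<close>
    have "(\<integral>\<^sup>+x. ennreal (lik_filt G y t x) \<partial>transition G t z)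
        = (\<integral>\<^sup>+v. ennreal (exp (- (norm (r z - ?B *v v))\<^sup>2 / 2)) * ennreal c \<partial>std_gaussian)"
      using \<open>0 < c\<close> by (simp add: transition nn_integral_distr lik_transition ennreal_mult' mult.commute)
    also have "\<dots> = ennreal (c * e z)"
      using \<open>0 < c\<close> e_pos[of z]
      by (simp only: tilt[OF borel_measurable_const] nn_integral_std_gaussian_const e_def[symmetric])
         (simp add: mult.commute flip: ennreal_mult')
    finally have "(\<integral>\<^sup>+x. ennreal (lik_filt G y t x) \<partial>transition G t z) = ennreal (c * e z)" .
    then show ?thesis
      unfolding lik_pred_def using \<open>0 < c\<close> e_pos[of z]
      by (subst integral_eq_nn_integral) (auto simp: transition lik)
  qed
  then show "lik_pred G y t x = c' * exp (- (1 / 2) * (norm (ybar' - Cbar' *v x))\<^sup>2)"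
    by (simp add: e_def norm_r c')
  have "transpose Rhat = Rhat"
    using pd by (simp add: pos_def_def)
  then have symI: "transpose ?Si = ?Si"
    by (rule matrix_inv_symmetric[OF inv])
  have symQ: "transpose ?Q = ?Q"
    using \<open>pos_semidef ?Q\<close> by (simp add: pos_semidef_def)
  \<comment> \<open>The middle factor collapses to the identity. Pulling \<open>A\<close> out on
    both sides then exposes \<open>D ** transpose D\<close>, so \<open>A ** D\<close> is a factor of
    \<open>Q'\<close>.\<close>
  have "Kbar ** Rhat ** transpose Kbar = ?Q ** transpose ?C ** (?Si ** Rhat) ** ?Si ** ?C ** ?Q"
    by (simp only: assms(11) matrix_transpose_mul symI symQ matrix_mul_assoc transpose_transpose)
  then have "Q' = ?Q - ?Q ** transpose ?C ** ?Si ** ?C ** ?Q"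
    by (simp add: assms(14) matrix_inv_left[OF inv])
  also have "\<dots> = A ** (mat 1 - transpose ?B ** ?Si ** ?B) ** transpose A"
    by (simp add: matrix_diff_ldistrib matrix_diff_rdistrib matrix_transpose_mul matrix_mul_assoc flip: A)
  also have "\<dots> = (A ** D) ** transpose (A ** D)"
    unfolding D[symmetric] by (simp only: matrix_transpose_mul matrix_mul_assoc)
  finally have Q': "(A ** D) ** transpose (A ** D) = Q'" ..
  \<comment> \<open>The gain appears because \<open>A ** transpose ?B\<close> equals
    \<open>?Q ** transpose ?C\<close>: it is the image under \<open>A\<close> of the shift of
    \<open>v\<close>.\<close>
  have "A *v (transpose ?B *v (?Si *v r z)) = Kbar *v r z"
    by (simp only: assms(11) A[symmetric] matrix_transpose_mul matrix_vector_mul_assoc matrix_mul_assoc)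
  then have mean: "m z + A *v (transpose ?B *v (?Si *v r z)) = Phi' *v z + u'"
    by (simp add: assms(12,13) r_def m_def matrix_vector_mult_diff_distrib matrix_vector_right_distrib
        matrix_diff_rdistrib matrix_vector_mult_diff_rdistrib matrix_vector_mul_assoc matrix_mul_assoc)
  show "post_transition G y t z = gaussian (Phi' *v z + u') Q'"
  proof (rule measure_eqI)
    show "sets (post_transition G y t z) = sets (gaussian (Phi' *v z + u') Q')"
      by (simp add: post_transition_def transition gaussian_eq_distr[OF Q'])
    fix E assume "E \<in> sets (post_transition G y t z)"
    then have [measurable]: "E \<in> sets borel"
      by (simp add: post_transition_def transition)
    \<comment> \<open>The constant \<open>c\<close> cancels between likelihood and normaliser,
      leaving the weight that \<open>tilt\<close> handles and the factor \<open>1 / e z\<close>,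
      which cancels next.\<close>
    have "emeasure (post_transition G y t z) E
        = (\<integral>\<^sup>+v. ennreal (exp (- (norm (r z - ?B *v v))\<^sup>2 / 2)) *
            (ennreal (1 / e z) * indicator E (m z + A *v v)) \<partial>std_gaussian)"
      using \<open>0 < c\<close> e_pos[of z]
      by (simp add: post_transition_def transition emeasure_density nn_integral_distr pred lik_transition
          mult.assoc[symmetric] flip: ennreal_mult'')
    also have "\<dots> = ennreal (e z) * (ennreal (1 / e z) *
        (\<integral>\<^sup>+v. indicator E (m z + A *v (transpose ?B *v (?Si *v r z) + D *v v)) \<partial>std_gaussian))"
      by (subst tilt, unfold e_def[symmetric]) (simp_all add: nn_integral_cmult)
    also have "\<dots> = (\<integral>\<^sup>+v. indicator E (m z + A *v (transpose ?B *v (?Si *v r z) + D *v v)) \<partial>std_gaussian)"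
      using e_pos[of z] by (simp add: mult.assoc[symmetric] flip: ennreal_mult'')
    also have "\<dots> = (\<integral>\<^sup>+v. indicator E (Phi' *v z + u' + (A ** D) *v v) \<partial>std_gaussian)"
      by (simp only: matrix_vector_right_distrib add.assoc[symmetric] mean)
         (simp only: matrix_vector_mul_assoc)
    also have "\<dots> = emeasure (gaussian (Phi' *v z + u') Q') E"
      by (simp add: gaussian_eq_distr[OF Q'] nn_integral_distr flip: nn_integral_indicator)
    finally show "emeasure (post_transition G y t z) E = emeasure (gaussian (Phi' *v z + u') Q') E" .
  qed
qed

end
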